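(* Let $M \ge 1$ and let $F : (\mathbb{R}/\mathbb{Z})^M \to \mathbb{C}$ be a trigonometric polynomial that is not identically zero. Let $\mathfrak{S} \subseteq \mathbb{Z}^M$ be a nonempty finite set of cardinality $N+1$ containing the support $\{\mathbf{k} \in \mathbb{Z}^M : \widehat{F}(\mathbf{k}) \ne 0\}$, so that $F(\mathbf{x}) = \sum_{\mathbf{k} \in \mathfrak{S}} \widehat{F}(\mathbf{k}) e^{2\pi i \mathbf{k}^T \mathbf{x}}$. Let $\boldsymbol{\alpha} = (\alpha_1, \dots, \alpha_M)^T \in \mathbb{R}^M$ have $\mathbb{Q}$-linearly independent coordinates, so that $\varphi_{\boldsymbol\alpha}(\mathbf{k}) = \mathbf{k}^T\boldsymbol\alpha$ is an injective homomorphism $\mathbb{Z}^M \to \mathbb{R}$, and index $\mathfrak{S} = \{\mathbf{k}_0, \mathbf{k}_1, \dots, \mathbf{k}_N\}$ so that $$\varphi_{\boldsymbol\alpha}(\mathbf{k}_0) < \varphi_{\boldsymbol\alpha}(\mathbf{k}_1) < \cdots < \varphi_{\boldsymbol\alpha}(\mathbf{k}_N).$$ Then $$|\widehat{F}(\mathbf{k}_n)| \le \binom{N}{n}\, \mathfrak{M}(F) \quad \text{for each } n = 0, 1, \dots, N.$$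
   Context: The Fourier transform of $F$ is $\widehat{F}(\mathbf{k}) = \int_{(\mathbb{R}/\mathbb{Z})^M} F(\mathbf{x}) e^{-2\pi i \mathbf{k}^T\mathbf{x}}\,d\mathbf{x}$ for $\mathbf{k} \in \mathbb{Z}^M$, with Haar measure normalized to total mass $1$. The Mahler measure of a not identically zero $F$ is $\mathfrak{M}(F) = \exp\left(\int_{(\mathbb{R}/\mathbb{Z})^M} \log|F(\mathbf{x})|\,d\mathbf{x}\right)$. *)

theory Defs
  imports "HOL-Analysis.Analysis"
begin

text \<open>
  A function on the torus \<open>(\<real>/\<int>)\<^sup>M\<close> is represented by its lift to \<open>real ^ 'm\<close> with
  \<open>M = CARD('m)\<close>, i.e. by a function that is 1-periodic in every coordinate. Normalized Haar measure
  on the torus becomes Lebesgue measure on the unit cube \<open>cbox 0 1\<close>.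
\<close>

definition int_dot :: "int ^ 'm \<Rightarrow> real ^ 'm \<Rightarrow> real" where
  "int_dot k x = (\<Sum>i\<in>UNIV. real_of_int (k $ i) * x $ i)"

definition torus_char :: "int ^ 'm \<Rightarrow> real ^ 'm \<Rightarrow> complex" where
  "torus_char k x = exp (2 * of_real pi * \<i> * of_real (int_dot k x))"

definition trig_polynomial :: "(real ^ 'm \<Rightarrow> complex) \<Rightarrow> bool" where
  "trig_polynomial F \<longleftrightarrow>
     (\<exists>T c. finite T \<and> (\<forall>x. F x = (\<Sum>k\<in>T. c k * torus_char k x)))"

definition fourier_coeff :: "(real ^ 'm \<Rightarrow> complex) \<Rightarrow> int ^ 'm \<Rightarrow> complex" where
  "fourier_coeff F k =
     (LINT x:cbox 0 1|lborel. F x * exp (- (2 * of_real pi * \<i> * of_real (int_dot k x))))"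

text \<open>
  For a trigonometric polynomial that is not identically zero, the zero set in the cube is null, so
  the value \<open>ln 0 = 0\<close> does not affect the integral, and \<open>ln (cmod (F x))\<close> is
  Lebesgue integrable on the cube, so the integral is the genuine one.
\<close>

definition mahler_measure :: "(real ^ 'm \<Rightarrow> complex) \<Rightarrow> real" where
  "mahler_measure F = exp (LINT x:cbox 0 1|lborel. ln (cmod (F x)))"

definition rat_lin_indep :: "real ^ 'm \<Rightarrow> bool" where
  "rat_lin_indep a \<longleftrightarrow>
     (\<forall>q :: rat ^ 'm. (\<Sum>i\<in>UNIV. of_rat (q $ i) * a $ i) = 0 \<longrightarrow> q = 0)"

lemma torus_char_periodic: "torus_char k (x + (\<chi> i. real_of_int (l $ i))) = torus_char k x"
proof -
  have "int_dot k (x + (\<chi> i. real_of_int (l $ i))) =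
      int_dot k x + real_of_int (\<Sum>i\<in>UNIV. k $ i * l $ i)"
    by (simp add: int_dot_def distrib_left sum.distrib)
  moreover have "exp (2 * complex_of_real pi * \<i> * of_real (real_of_int n)) = 1" for n
    using exp_integer_2pi[of "of_int n"] by (simp add: mult_ac)
  ultimately show ?thesis
    by (simp only: torus_char_def of_real_add distrib_left exp_add mult_1_right)
qed

lemma trig_polynomial_periodic:
  "trig_polynomial F \<Longrightarrow> F (x + (\<chi> i. real_of_int (l $ i))) = F x"
  by (auto simp: trig_polynomial_def torus_char_periodic)

end

theory Submission
  imports Defs "HOL-Complex_Analysis.Complex_Analysis"
    "HOL-Computational_Algebra.Fundamental_Theorem_Algebra"
begin

unbundle no fps_syntax

text \<open>
  In one variable the bound follows by induction on \<open>N\<close> from Mahler's inequality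
  \<open>M(p') \<le> deg p * M(p)\<close>. With \<open>m\<^sub>0 < \<dots> < m\<^sub>N\<close> the exponents of \<open>f\<close>, differentiating
  \<open>f / z ^ m\<^sub>0\<close> removes the lowest term and differentiating the reversed polynomial removes the highest
  one; the two resulting bounds for \<open>(m\<^sub>n - m\<^sub>0) * |c\<^sub>n|\<close> and \<open>(m\<^sub>N - m\<^sub>n) * |c\<^sub>n|\<close> add up by Pascal's rule.

  Mahler's inequality: reflecting the zeros of \<open>p\<close> into the unit disc gives \<open>q\<close> with \<open>|q| = |p|\<close> on the
  circle and \<open>|p| \<le> |q|\<close> outside. For \<open>|\<lambda>| > 1\<close> the zeros of \<open>p - \<lambda> q\<close> lie in the closed disc, hence by
  Gauss--Lucas those of \<open>p' - \<lambda> q'\<close> do too, so \<open>|p'| \<le> |q'|\<close> on the circle; and Jensen's formula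
  evaluates \<open>M(q)\<close> and \<open>M(q')\<close> by leading coefficients.

  In several variables an integer vector \<open>a\<close> close to a multiple of \<open>\<alpha>\<close> induces the same ordering of the
  frequencies. The one-variable bound applies to \<open>t \<mapsto> F (x + t a)\<close> for every \<open>x\<close>, and averaging its
  logarithm over \<open>x\<close> gives the theorem, by Tonelli and translation invariance.
\<close>

section \<open>Polynomials dominated on the exterior of the unit disc\<close>

text \<open>With \<open>u = x / z\<close> in the unit disc, the quotient is
  \<open>1 / (1 - u)\<close>, and this map sends the disc into the half-plane
  \<open>Re > 1/2\<close>. In the computation, twice the real part of \<open>z * cnj (z - x)\<close>
  exceeds the squared modulus of \<open>z - x\<close> by exactly |z|^2 - |x|^2.\<close>

lemma Re_divide_diff_ge_half:
  fixes z x :: complex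
  assumes "norm x \<le> 1" "norm z > 1"
  shows "Re (z / (z - x)) \<ge> 1 / 2"
proof -
  have "z \<noteq> x" using assms by auto
  hence pos: "(cmod (z - x))\<^sup>2 > 0" by simp
  have "(cmod x)\<^sup>2 \<le> (cmod z)\<^sup>2" using assms by (intro power_mono) auto
  hence "(cmod (z - x))\<^sup>2 \<le> 2 * Re (z * cnj (z - x))"
    unfolding cmod_power2 by (simp add: power2_eq_square algebra_simps)
  moreover have "Re (z / (z - x)) = Re (z * cnj (z - x)) / (cmod (z - x))\<^sup>2"
    using complex_div_cnj[of z "z - x"] by (simp add: Re_divide_of_real)
  ultimately show ?thesis using pos by (simp only: pos_le_divide_eq)
qed

text \<open>The logarithmic derivative is the sum of \<open>1 / (z - x)\<close> over the roots, so
  after multiplication by \<open>z\<close> each root contributes real part at least 1/2.\<close>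

lemma Re_log_pderiv_ge:
  fixes A :: "complex multiset"
  assumes "\<forall>x\<in>#A. norm x \<le> 1" "norm z > 1"
  defines "p \<equiv> \<Prod>x\<in>#A. [:-x, 1:]"
  shows "poly p z \<noteq> 0" "Re (z * poly (pderiv p) z / poly p z) \<ge> size A / 2"
proof -
  have "poly p z \<noteq> 0 \<and> Re (z * poly (pderiv p) z / poly p z) \<ge> size A / 2"
    using assms(1) unfolding p_def
  proof (induction A)
    case empty
    show ?case by simp
  next
    case (add x A)
    define q where "q = (\<Prod>x\<in>#A. [:-x, 1:])"
    have q: "poly q z \<noteq> 0" "Re (z * poly (pderiv q) z / poly q z) \<ge> size A / 2"
      using add by (auto simp: q_def)
    have zx: "z - x \<noteq> 0" using add.prems assms(2) by auto
    have *: "poly ([:-x, 1:] * q) z = (z - x) * poly q z"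
      "poly (pderiv ([:-x, 1:] * q)) z = poly q z + (z - x) * poly (pderiv q) z"
      by (simp_all only: pderiv_mult poly_add poly_mult) (simp_all add: pderiv_pCons algebra_simps)
    have "z * poly (pderiv ([:-x, 1:] * q)) z / poly ([:-x, 1:] * q) z
        = z / (z - x) + z * poly (pderiv q) z / poly q z"
      unfolding * using zx q(1) by (simp add: field_simps)
    moreover have "Re (z / (z - x)) \<ge> 1 / 2"
      using add.prems assms(2) by (intro Re_divide_diff_ge_half) auto
    ultimately have "Re (z * poly (pderiv ([:-x, 1:] * q)) z / poly ([:-x, 1:] * q) z)
        \<ge> size (add_mset x A) / 2"
      using q(2) by (simp add: field_simps)
    moreover have "poly ([:-x, 1:] * q) z \<noteq> 0" unfolding * using zx q(1) by simp
    ultimately show ?case by (simp only: q_def image_mset_add_mset prod_mset.add_mset simp_thms)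
  qed
  thus "poly p z \<noteq> 0" "Re (z * poly (pderiv p) z / poly p z) \<ge> size A / 2" by auto
qed

text \<open>Outside the disc \<open>z * p'(z) / p(z)\<close> has real part at least
  \<open>degree p / 2 > 0\<close>, so its numerator cannot vanish.\<close>

lemma Gauss_Lucas_unit_disc:
  fixes p :: "complex poly"
  assumes "degree p > 0" "\<And>z. norm z > 1 \<Longrightarrow> poly p z \<noteq> 0" "norm z > 1"
  shows "poly (pderiv p) z \<noteq> 0"
proof -
  obtain A where A: "size A = degree p" "p = smult (lead_coeff p) (\<Prod>x\<in>#A. [:-x, 1:])"
    using alg_closed_imp_factorization[of p] assms(1) by force
  let ?q = "\<Prod>x\<in>#A. [:-x, 1:]"
  have lc: "lead_coeff p \<noteq> 0" using assms(1) by auto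
  have "norm x \<le> 1" if "x \<in># A" for x
  proof -
    have "poly ?q x = 0" using that by (auto simp: poly_prod_mset image_image)
    hence "poly p x = 0" by (subst A(2)) simp
    thus ?thesis using assms(2)[of x] by force
  qed
  from Re_log_pderiv_ge(2)[of A z] this assms(3)
  have "Re (z * poly (pderiv ?q) z / poly ?q z) \<ge> degree p / 2" using A(1) by auto
  with assms(1) have "poly (pderiv ?q) z \<noteq> 0" by auto
  thus ?thesis using lc by (subst A(2)) (simp add: pderiv_smult)
qed

text \<open>The difference of the squared moduli factors as (|r|^2 - 1)(|z|^2 - 1).\<close>

lemma cmod_diff_le_reflected:
  fixes z r :: complex
  assumes "norm r > 1" "norm z \<ge> 1"
  shows "cmod (z - r) \<le> cmod (1 - cnj r * z)"
proof -
  have "(cmod (1 - cnj r * z))\<^sup>2 - (cmod (z - r))\<^sup>2 = ((cmod r)\<^sup>2 - 1) * ((cmod z)\<^sup>2 - 1)"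
    unfolding cmod_power2 by (simp add: power2_eq_square algebra_simps)
  moreover have "\<dots> \<ge> 0" using assms by (intro mult_nonneg_nonneg) auto
  ultimately have "(cmod (z - r))\<^sup>2 \<le> (cmod (1 - cnj r * z))\<^sup>2" by linarith
  thus ?thesis by (rule power2_le_imp_le) simp
qed

text \<open>On the circle \<open>z * cnj z = 1\<close>, so the reflected factor is
  \<open>z * cnj (z - r)\<close>.\<close>

lemma cmod_diff_eq_reflected:
  fixes z r :: complex
  assumes "norm z = 1"
  shows "cmod (z - r) = cmod (1 - cnj r * z)"
proof -
  have "z * cnj (z - r) = 1 - cnj r * z"
    using assms complex_norm_square[of z] by (simp add: algebra_simps)
  hence "cmod (1 - cnj r * z) = cmod (z * cnj (z - r))" by simp
  also have "\<dots> = cmod (z - r)" using assms by (simp only: norm_mult complex_mod_cnj)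
  finally show ?thesis ..
qed

text \<open>Every zero \<open>r\<close> outside the closed disc is replaced by its reflection \<open>1 / cnj r\<close>.\<close>

lemma reflect_roots_into_disc:
  fixes p :: "complex poly"
  assumes "p \<noteq> 0"
  obtains q where "degree q = degree p" "cmod (lead_coeff p) \<le> cmod (lead_coeff q)"
    "\<And>z. norm z > 1 \<Longrightarrow> poly q z \<noteq> 0"
    "\<And>z. norm z \<ge> 1 \<Longrightarrow> cmod (poly p z) \<le> cmod (poly q z)"
    "\<And>z. norm z = 1 \<Longrightarrow> cmod (poly p z) = cmod (poly q z)"
proof -
  \<comment> \<open>Bundles the required properties so that an induction can carry them while adding
    one root of \<open>p\<close> at a time.\<close>
  define good where "good p q \<longleftrightarrow> degree q = degree p \<and> cmod (lead_coeff p) \<le> cmod (lead_coeff q)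
    \<and> (\<forall>z. norm z > 1 \<longrightarrow> poly q z \<noteq> 0)
    \<and> (\<forall>z. norm z \<ge> 1 \<longrightarrow> cmod (poly p z) \<le> cmod (poly q z))
    \<and> (\<forall>z. norm z = 1 \<longrightarrow> cmod (poly p z) = cmod (poly q z))" for p q :: "complex poly"
  have step: "\<exists>q'. q' \<noteq> 0 \<and> good ([:-r, 1:] * p) q'" if "good p q" "p \<noteq> 0" "q \<noteq> 0" for p q r
  proof (cases "norm r \<le> 1")
    case True
    \<comment> \<open>A root in the closed disc needs no reflection; both polynomials receive the
      same factor.\<close>
    have pl: "poly ([:-r, 1:] * h) z = (z - r) * poly h z" for h z
      by (simp add: algebra_simps)
    have "good ([:-r, 1:] * p) ([:-r, 1:] * q)"
      unfolding good_def pl norm_mult lead_coeff_mult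
    proof (intro conjI allI impI)
      show "degree ([:-r, 1:] * q) = degree ([:-r, 1:] * p)"
        using that by (subst (1 2) degree_mult_eq) (auto simp: good_def)
    qed (use that True in \<open>auto simp: good_def intro!: mult_left_mono\<close>)
    thus ?thesis using that by (intro exI[of _ "[:-r, 1:] * q"]) (simp only: mult_eq_0_iff, simp)
  next
    case False
    \<comment> \<open>Here \<open>1 - cnj r * z\<close> replaces \<open>z - r\<close>: its zero lies
      inside the disc, and its leading coefficient has modulus \<open>cmod r > 1\<close>, so the
      leading coefficient of \<open>q\<close> only grows relative to that of
      \<open>p\<close>.\<close>
    hence r: "r \<noteq> 0" "norm r > 1" by auto
    have nz: "1 - cnj r * z \<noteq> 0" if "norm z > 1" for z
    proof
      assume "1 - cnj r * z = 0"
      hence "cmod (cnj r * z) = 1" by (metis eq_iff_diff_eq_0 norm_one)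
      moreover have "cmod r * cmod z > 1" using r that by (simp add: less_1_mult)
      ultimately show False by (simp add: norm_mult)
    qed
    have pl: "poly ([:-r, 1:] * p) z = (z - r) * poly p z"
       "poly ([:1, -cnj r:] * q) z = (1 - cnj r * z) * poly q z" for z
      by (simp_all add: algebra_simps)
    have d: "degree ([:1, -cnj r:] * q) = degree ([:-r, 1:] * p)"
      using that r by (subst (1 2) degree_mult_eq) (auto simp: good_def)
    have l: "cmod (lead_coeff ([:-r, 1:] * p)) \<le> cmod (lead_coeff ([:1, -cnj r:] * q))"
    proof -
      have "cmod (lead_coeff p) \<le> cmod (lead_coeff q)" using that unfolding good_def by blast
      also have "\<dots> \<le> cmod r * cmod (lead_coeff q)" using r by (simp add: mult_le_cancel_right1)
      finally show ?thesis
        using r by (simp only: lead_coeff_mult norm_mult) simp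
    qed
    have "good ([:-r, 1:] * p) ([:1, -cnj r:] * q)"
      unfolding good_def
    proof (intro conjI allI impI)
      fix z :: complex assume "norm z > 1"
      thus "poly ([:1, -cnj r:] * q) z \<noteq> 0" using that nz[of z] unfolding pl by (simp add: good_def)
    next
      fix z :: complex assume z: "norm z \<ge> 1"
      show "cmod (poly ([:-r, 1:] * p) z) \<le> cmod (poly ([:1, -cnj r:] * q) z)"
        unfolding pl norm_mult using that z cmod_diff_le_reflected[OF r(2) z]
        by (intro mult_mono) (auto simp: good_def)
    next
      fix z :: complex assume z: "norm z = 1"
      show "cmod (poly ([:-r, 1:] * p) z) = cmod (poly ([:1, -cnj r:] * q) z)"
        unfolding pl norm_mult using that z cmod_diff_eq_reflected[OF z]
        by (auto simp: good_def)
    qed (use d l in auto)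
    thus ?thesis using that by (intro exI[of _ "[:1, -cnj r:] * q"]) (simp only: mult_eq_0_iff, simp)
  qed
  obtain A where A: "p = smult (lead_coeff p) (\<Prod>x\<in>#A. [:-x, 1:])"
    using alg_closed_imp_factorization[of p] assms by blast
  have "\<exists>q. q \<noteq> 0 \<and> good (smult c (\<Prod>x\<in>#A. [:-x, 1:])) q" if "c \<noteq> 0" for c
  proof (induction A)
    case empty
    show ?case using that by (intro exI[of _ "[:c:]"]) (auto simp: good_def)
  next
    case (add x A)
    then obtain q where q: "q \<noteq> 0" "good (smult c (\<Prod>x\<in>#A. [:-x, 1:])) q" by blast
    have "smult c (\<Prod>x\<in>#A. [:-x, 1:]) \<noteq> 0"
      using that by (auto simp: prod_mset_zero_iff)
    from step[OF q(2) this q(1), of x] show ?case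
      by (simp only: image_mset_add_mset prod_mset.add_mset mult_smult_right)
  qed
  from this[of "lead_coeff p"] A assms obtain q where "good p q"
    by (metis leading_coeff_0_iff)
  thus ?thesis using that[of q] by (auto simp: good_def)
qed

text \<open>Domination outside the disc keeps \<open>p - l * q\<close> free of zeros there whenever
  \<open>cmod l > 1\<close>. By Gauss-Lucas the same holds for its derivative, which excludes
  \<open>l\<close> as a value of \<open>p' / q'\<close>.\<close>

lemma cmod_pderiv_le_of_dominated:
  fixes p q :: "complex poly"
  assumes deg: "degree q = degree p" and lc: "cmod (lead_coeff p) \<le> cmod (lead_coeff q)"
    and "degree p > 0"
    and nz: "\<And>z. norm z > 1 \<Longrightarrow> poly q z \<noteq> 0"
    and le: "\<And>z. norm z \<ge> 1 \<Longrightarrow> cmod (poly p z) \<le> cmod (poly q z)"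
    and z: "norm z = 1"
  shows "cmod (poly (pderiv p) z) \<le> cmod (poly (pderiv q) z)"
proof -
  have outer: "cmod (poly (pderiv p) w) \<le> cmod (poly (pderiv q) w)" if w: "norm w > 1" for w
  proof (rule ccontr)
    assume "\<not> ?thesis"
    hence gt: "cmod (poly (pderiv q) w) < cmod (poly (pderiv p) w)" by simp
    have qw: "poly (pderiv q) w \<noteq> 0"
      using Gauss_Lucas_unit_disc[of q w] assms w by auto
    \<comment> \<open>This multiplier makes \<open>w\<close> a zero of the derivative of
      \<open>p - smult l q\<close>.\<close>
    define l where "l = poly (pderiv p) w / poly (pderiv q) w"
    have l: "cmod l > 1" using gt qw by (simp add: l_def norm_divide)
    define h where "h = p - smult l q"
    have lcq: "cmod (lead_coeff q) > 0" using assms(1,3) by (metis degree_0 leading_coeff_0_iff less_irrefl zero_less_norm_iff)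
    \<comment> \<open>The leading coefficients of \<open>p\<close> and \<open>smult l q\<close> have
      different moduli and cannot cancel, so \<open>h\<close> has positive degree, as Gauss-Lucas
      requires.\<close>
    have "cmod (lead_coeff p) < cmod l * cmod (lead_coeff q)"
      using lc l lcq by (smt (verit, best) mult_less_cancel_right1)
    hence "coeff h (degree p) \<noteq> 0"
      using deg by (auto simp: h_def simp flip: norm_mult)
    hence "degree h > 0" using le_degree assms(3) by fastforce
    moreover have "poly h v \<noteq> 0" if v: "norm v > 1" for v
    proof
      assume "poly h v = 0"
      hence "cmod (poly p v) = cmod l * cmod (poly q v)" by (simp add: h_def norm_mult)
      moreover have "cmod (poly q v) > 0" using nz[OF v] by simp
      ultimately show False using le[of v] v l by (smt (verit, best) mult_less_cancel_right1)
    qed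
    ultimately have "poly (pderiv h) w \<noteq> 0" using Gauss_Lucas_unit_disc[of h w] w by blast
    thus False using qw by (simp add: h_def l_def pderiv_diff pderiv_smult)
  qed
  \<comment> \<open>Points of the circle are approached radially from outside, and the inequality
    passes to the limit by continuity.\<close>
  have lim: "(\<lambda>n. of_real (1 + 1 / real (Suc n)) * z) \<longlonglongrightarrow> of_real (1 + 0) * z"
    by (intro tendsto_intros LIMSEQ_inverse_real_of_nat[unfolded inverse_eq_divide])
  have "norm (of_real (1 + 1 / real (Suc n)) * z) > 1" for n
    unfolding norm_mult norm_of_real z by (simp add: field_simps)
  hence ev: "\<forall>\<^sub>F n in sequentially. cmod (poly (pderiv p) (of_real (1 + 1 / real (Suc n)) * z))
      \<le> cmod (poly (pderiv q) (of_real (1 + 1 / real (Suc n)) * z))"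
    using outer by (intro always_eventually) blast
  have "cmod (poly (pderiv p) (of_real (1 + 0) * z)) \<le> cmod (poly (pderiv q) (of_real (1 + 0) * z))"
    by (rule tendsto_le[OF _ _ _ ev]) (intro tendsto_intros lim trivial_limit_sequentially)+
  thus ?thesis by simp
qed

section \<open>Jensen's formula and Mahler's inequality\<close>

abbreviation unit_measure :: "real measure" where
  "unit_measure \<equiv> restrict_space lborel {0..1}"

abbreviation circ :: "real \<Rightarrow> complex" where
  "circ t \<equiv> cis (2 * pi * t)"

lemma finite_measure_unit: "finite_measure unit_measure"
  by (rule finite_measureI) (simp add: emeasure_restrict_space space_restrict_space)

lemma measure_unit [simp]: "measure unit_measure {0..1} = 1"
  by (simp add: measure_restrict_space)

lemma integrable_unit_const [simp]: "integrable unit_measure (\<lambda>_. c :: real)"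
  using finite_measure.integrable_const[OF finite_measure_unit] .

lemma integrable_unit_continuous:
  fixes f :: "real \<Rightarrow> real"
  assumes "continuous_on {0..1} f"
  shows "integrable unit_measure f"
  using borel_integrable_compact[of "{0..1}" f] assms
  by (subst integrable_restrict_space) auto

lemma has_integral_imp_integral_unit:
  fixes f :: "real \<Rightarrow> real"
  assumes "continuous_on {0..1} f" "(f has_integral y) {0..1}"
  shows "integral\<^sup>L unit_measure f = y"
proof -
  have "set_integrable lborel {0..1} f" using assms(1) by (rule borel_integrable_atLeastAtMost')
  from set_borel_integral_eq_integral(2)[OF this] assms(2) show ?thesis
    by (subst integral_restrict_space) (auto simp: set_lebesgue_integral_def integral_unique)
qed

text \<open>Each fibre of \<open>circ\<close> lies in a translate of the integers, so the preimage
  of a finite set is countable and hence null. This makes the default \<open>ln 0 = 0\<close>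
  harmless in the integrals below.\<close>

lemma AE_circ_notin:
  assumes "finite R"
  shows "AE t in unit_measure. circ t \<notin> R"
proof -
  have count: "countable {t. circ t = r}" for r
  proof (cases "\<exists>t0. circ t0 = r")
    case True
    then obtain t0 where t0: "circ t0 = r" by blast
    have "{t. circ t = r} \<subseteq> range (\<lambda>n::int. t0 + of_int n)"
    proof
      fix t assume "t \<in> {t. circ t = r}"
      hence "circ t / circ t0 = 1" using t0 by (metis (mono_tags) cis_neq_zero divide_self mem_Collect_eq)
      hence "cis (2 * pi * t - 2 * pi * t0) = 1" by (simp only: cis_divide)
      hence "cos (2 * pi * t - 2 * pi * t0) = 1" by (metis cis.sel(1) one_complex.sel(1))
      then obtain n :: int where "2 * pi * t - 2 * pi * t0 = of_int n * 2 * pi"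
        using cos_one_2pi_int by blast
      hence "2 * pi * (t - t0 - of_int n) = 0" by (simp add: algebra_simps)
      hence "t = t0 + of_int n" by simp
      thus "t \<in> range (\<lambda>n::int. t0 + of_int n)" by blast
    qed
    thus ?thesis by (rule countable_subset) simp
  qed auto
  have "{t. circ t \<in> R} = (\<Union>r\<in>R. {t. circ t = r})" by auto
  hence "countable {t. circ t \<in> R}" using assms count by (simp add: countable_finite)
  hence "{t. circ t \<in> R} \<in> null_sets lborel" by (rule countable_imp_null_set_lborel)
  hence "AE t in lborel. circ t \<notin> R" using AE_not_in by fastforce
  thus ?thesis by (subst AE_restrict_space_iff) auto
qed

lemma continuous_on_ln_cmod_circ:
  assumes "norm r \<noteq> 1"
  shows "continuous_on A (\<lambda>t. ln (cmod (circ t - r)))"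
proof -
  have "circ t \<noteq> r" for t using assms norm_cis by metis
  thus ?thesis by (intro continuous_intros) auto
qed

text \<open>Mean value property of a holomorphic logarithm. The logarithm of \<open>z - r\<close>
  has a branch point inside the disc, but the reflected factor has the same modulus on the circle
  and no zero in the closed disc.\<close>

lemma integral_ln_cmod_circ_less:
  assumes r: "norm r < 1"
  shows "integral\<^sup>L unit_measure (\<lambda>t. ln (cmod (circ t - r))) = 0"
proof (rule has_integral_imp_integral_unit)
  show "continuous_on {0..1} (\<lambda>t. ln (cmod (circ t - r)))"
    using r by (intro continuous_on_ln_cmod_circ) auto
  \<comment> \<open>The principal branch is holomorphic on the closed disc because its argument has
    positive real part there; moreover \<open>h 0 = 0\<close>, which is the mean obtained.\<close>
  define h where "h z = Ln (1 - cnj r * z)" for z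
  have pos: "Re (1 - cnj r * z) > 0" if "norm z \<le> 1" for z
  proof -
    have "Re (cnj r * z) \<le> cmod (cnj r * z)" by (rule complex_Re_le_cmod)
    also have "\<dots> \<le> cmod r * 1" unfolding norm_mult complex_mod_cnj using that by (intro mult_left_mono) auto
    finally show ?thesis using r by simp
  qed
  have "h holomorphic_on cball 0 1" unfolding h_def
  proof (intro holomorphic_intros)
    fix z :: complex assume "z \<in> cball 0 1"
    hence "Re (1 - cnj r * z) > 0" by (intro pos) simp
    thus "1 - cnj r * z \<notin> \<real>\<^sub>\<le>\<^sub>0" using complex_nonpos_Reals_iff by (metis not_less)
  qed
  from Cauchy_integral_circlepath_simple[OF this, of 0]
  have "((\<lambda>u. h u / u) has_contour_integral 0) (circlepath 0 1)" by (simp add: h_def)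
  hence "((\<lambda>x. h (circlepath 0 1 x) / circlepath 0 1 x *
      vector_derivative (circlepath 0 1) (at x within {0..1})) has_integral 0) {0..1}"
    by (simp add: has_contour_integral_def)
  hence "((\<lambda>x. h (circ x) * (2 * pi * \<i>)) has_integral 0) {0..1}"
  proof (rule has_integral_eq[rotated])
    fix x :: real assume "x \<in> {0..1}"
    moreover have "exp (2 * complex_of_real pi * \<i> * complex_of_real x) = circ x"
      by (simp add: cis_conv_exp mult_ac)
    ultimately show "h (circlepath 0 1 x) / circlepath 0 1 x *
        vector_derivative (circlepath 0 1) (at x within {0..1}) = h (circ x) * (2 * pi * \<i>)"
      by (simp add: vector_derivative_circlepath01) (simp add: circlepath)
  qed
  from has_integral_mult_left[OF this, of "1 / (2 * pi * \<i>)"]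
  have "((\<lambda>x. h (circ x)) has_integral 0) {0..1}" by simp
  from has_integral_linear[OF this bounded_linear_Re]
  have "((\<lambda>x. Re (h (circ x))) has_integral 0) {0..1}" by (simp add: o_def)
  moreover have "Re (h (circ x)) = ln (cmod (circ x - r))" for x
  proof -
    have "1 - cnj r * circ x \<noteq> 0" using pos[of "circ x"] by (metis less_irrefl norm_cis order_refl zero_complex.sel(1))
    from Re_Ln[OF this] show ?thesis unfolding h_def by (simp only: cmod_diff_eq_reflected norm_cis)
  qed
  ultimately show "((\<lambda>x. ln (cmod (circ x - r))) has_integral 0) {0..1}" by simp
qed

lemma borel_measurable_ln_cmod_poly [measurable]:
  "(\<lambda>t. ln (cmod (poly p (circ t)))) \<in> borel_measurable unit_measure"
proof -
  have "(\<lambda>t. poly p (circ t)) \<in> borel_measurable borel"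
    by (intro borel_measurable_continuous_onI continuous_intros)
  hence "(\<lambda>t. ln (cmod (poly p (circ t)))) \<in> borel_measurable borel" by measurable
  thus ?thesis by (intro measurable_restrict_space1) simp
qed

text \<open>The singularity on the circle is approached by interior points \<open>s n\<close>, whose
  means are already known to vanish: Fatou's lemma gives integrability, and dominated convergence
  then gives the value.\<close>

lemma ln_cmod_circ_unit:
  assumes r: "norm r = 1"
  shows "integrable unit_measure (\<lambda>t. ln (cmod (circ t - r)))"
    and "integral\<^sup>L unit_measure (\<lambda>t. ln (cmod (circ t - r))) = 0"
proof -
  define s where "s n = of_real (1 - 1 / real (Suc n)) * r" for n
  have s_norm_eq: "norm (s n) = 1 - 1 / real (Suc n)" for n
    unfolding s_def norm_mult r norm_of_real by simp
  have s_norm: "norm (s n) < 1" for n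
    unfolding s_norm_eq by simp
  have s_diff: "norm (r - s n) = 1 / real (Suc n)" for n
  proof -
    have "r - s n = of_real (1 / real (Suc n)) * r" by (simp add: s_def algebra_simps)
    thus ?thesis by (simp only: norm_mult r norm_of_real) simp
  qed
  have "s \<longlonglongrightarrow> of_real (1 - 0) * r" unfolding s_def
    by (intro tendsto_intros LIMSEQ_inverse_real_of_nat[unfolded inverse_eq_divide])
  hence lim: "s \<longlonglongrightarrow> r" by simp
  have meas [measurable]: "(\<lambda>t. ln (cmod (circ t - a))) \<in> borel_measurable unit_measure" for a
    using borel_measurable_ln_cmod_poly[of "[:-a, 1:]"] by simp
  have intg: "integrable unit_measure (\<lambda>t. ln (cmod (circ t - s n)))" for n
    using s_norm[of n] by (intro integrable_unit_continuous continuous_on_ln_cmod_circ) auto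
  \<comment> \<open>A common upper bound turns the logarithms into nonnegative functions
    \<open>ln 2 - ln ...\<close> for Fatou; at a coincidence point the default
    \<open>ln 0 = 0\<close> respects it too.\<close>
  have upper: "ln (cmod (circ t - a)) \<le> ln 2" if "norm a \<le> 1" for t a
  proof (cases "circ t = a")
    case False
    have "cmod (circ t - a) \<le> 2" using norm_triangle_ineq4[of "circ t" a] that by simp
    thus ?thesis using False by (subst ln_le_cancel_iff) auto
  qed simp
  have ne: "AE t in unit_measure. circ t \<noteq> r" using AE_circ_notin[of "{r}"] by simp
  have conv: "(\<lambda>n. ln (cmod (circ t - s n))) \<longlonglongrightarrow> ln (cmod (circ t - r))" if "circ t \<noteq> r" for t
    using that by (intro tendsto_intros lim) auto
  have "(\<integral>\<^sup>+t. ennreal (ln 2 - ln (cmod (circ t - r))) \<partial>unit_measure)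
      = (\<integral>\<^sup>+t. liminf (\<lambda>n. ennreal (ln 2 - ln (cmod (circ t - s n)))) \<partial>unit_measure)"
    using ne
  proof (intro nn_integral_cong_AE, eventually_elim)
    case (elim t)
    show ?case
      by (intro lim_imp_Liminf[symmetric] tendsto_ennrealI tendsto_intros conv elim) simp
  qed
  \<comment> \<open>Fatou's lemma; each integral on the right equals \<open>ln 2\<close> because the
    logarithm has mean 0.\<close>
  also have "\<dots> \<le> liminf (\<lambda>n. \<integral>\<^sup>+t. ennreal (ln 2 - ln (cmod (circ t - s n))) \<partial>unit_measure)"
    by (intro nn_integral_liminf) measurable
  also have "\<dots> = liminf (\<lambda>n. ennreal (ln 2))"
  proof -
    have "(\<integral>\<^sup>+t. ennreal (ln 2 - ln (cmod (circ t - s n))) \<partial>unit_measure) = ennreal (ln 2)" for n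
      using upper[of "s n"] s_norm[of n] integral_ln_cmod_circ_less[of "s n"] intg[of n]
      by (subst nn_integral_eq_integral) (auto simp: less_imp_le)
    thus ?thesis by simp
  qed
  also have "\<dots> < \<infinity>" by (simp add: Liminf_const)
  finally have fin: "(\<integral>\<^sup>+t. ennreal (ln 2 - ln (cmod (circ t - r))) \<partial>unit_measure) < \<infinity>" .
  have "integrable unit_measure (\<lambda>t. ln 2 - ln (cmod (circ t - r)))"
    using upper[of r] r fin by (intro integrableI_nonneg) auto
  from Bochner_Integration.integrable_diff[OF integrable_unit_const[of "ln 2"] this]
  show I: "integrable unit_measure (\<lambda>t. ln (cmod (circ t - r)))" by simp
  have bound: "\<bar>ln (cmod (circ t - s n))\<bar> \<le> ln 2 + \<bar>ln (cmod (circ t - r))\<bar>" if "circ t \<noteq> r" for t n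
  proof -
    have pos: "cmod (circ t - s n) > 0" using s_norm[of n] norm_cis by (metis less_irrefl right_minus_eq zero_less_norm_iff)
    \<comment> \<open>\<open>r\<close> is the point of the circle nearest to \<open>s n\<close>.
      Hence \<open>circ t\<close> is at most twice as far from \<open>r\<close> as from
      \<open>s n\<close>, which bounds the logarithm from below uniformly in
      \<open>n\<close>.\<close>
    have "cmod (r - s n) \<le> cmod (circ t - s n)"
    proof -
      have "cmod (r - s n) = 1 - cmod (s n)"
        unfolding s_diff s_norm_eq by simp
      also have "\<dots> \<le> cmod (circ t - s n)" using norm_triangle_ineq2[of "circ t" "s n"] by simp
      finally show ?thesis .
    qed
    hence "cmod (circ t - r) \<le> 2 * cmod (circ t - s n)"
      using norm_triangle_ineq4[of "circ t - s n" "r - s n"] by (simp add: algebra_simps)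
    hence "ln (cmod (circ t - r)) \<le> ln (2 * cmod (circ t - s n))"
      using that pos by (subst ln_le_cancel_iff) auto
    also have "\<dots> = ln 2 + ln (cmod (circ t - s n))" using pos by (subst ln_mult) auto
    finally show ?thesis using upper[of "s n" t] s_norm[of n] by auto
  qed
  have "(\<lambda>n. integral\<^sup>L unit_measure (\<lambda>t. ln (cmod (circ t - s n))))
      \<longlonglongrightarrow> integral\<^sup>L unit_measure (\<lambda>t. ln (cmod (circ t - r)))"
  proof (rule integral_dominated_convergence[where w = "\<lambda>t. ln 2 + \<bar>ln (cmod (circ t - r))\<bar>"])
    show "AE t in unit_measure. (\<lambda>n. ln (cmod (circ t - s n))) \<longlonglongrightarrow> ln (cmod (circ t - r))"
      using ne by eventually_elim (rule conv)
    show "AE t in unit_measure. norm (ln (cmod (circ t - s n))) \<le> ln 2 + \<bar>ln (cmod (circ t - r))\<bar>" for n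
      using ne by eventually_elim (use bound in auto)
  qed (use I in auto)
  moreover have "integral\<^sup>L unit_measure (\<lambda>t. ln (cmod (circ t - s n))) = 0" for n
    using integral_ln_cmod_circ_less[OF s_norm] .
  ultimately show "integral\<^sup>L unit_measure (\<lambda>t. ln (cmod (circ t - r))) = 0"
    by (simp add: LIMSEQ_const_iff)
qed

lemma integrable_ln_cmod_circ: "integrable unit_measure (\<lambda>t. ln (cmod (circ t - r)))"
  using ln_cmod_circ_unit(1) continuous_on_ln_cmod_circ integrable_unit_continuous by blast

lemma integral_ln_cmod_circ_le:
  "norm r \<le> 1 \<Longrightarrow> integral\<^sup>L unit_measure (\<lambda>t. ln (cmod (circ t - r))) = 0"
  using ln_cmod_circ_unit(2) integral_ln_cmod_circ_less by (cases "norm r = 1") auto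

lemma AE_poly_circ_neq_0:
  assumes "p \<noteq> 0"
  shows "AE t in unit_measure. poly p (circ t) \<noteq> 0"
  using AE_circ_notin[OF poly_roots_finite[OF assms]] by simp

section \<open>Jensen's formula for polynomials with all zeros in the closed disc\<close>

definition log_mahler :: "complex poly \<Rightarrow> real" where
  "log_mahler p = integral\<^sup>L unit_measure (\<lambda>t. ln (cmod (poly p (circ t))))"

text \<open>Induction on the roots. The logarithm of a product splits into a sum away from the
  zeros, which suffices because they are met only on a null set of \<open>t\<close>.\<close>

lemma Jensen_prod:
  fixes A :: "complex multiset"
  defines "p \<equiv> \<Prod>x\<in>#A. [:-x, 1:]"
  shows "integrable unit_measure (\<lambda>t. ln (cmod (poly p (circ t)))) \<and>
    ((\<forall>x\<in>#A. norm x \<le> 1) \<longrightarrow> log_mahler p = 0)"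
  unfolding p_def
proof (induction A)
  case empty
  show ?case by (simp add: log_mahler_def)
next
  case (add x A)
  define q where "q = (\<Prod>x\<in>#A. [:-x, 1:])"
  have "q \<noteq> 0" by (auto simp: q_def prod_mset_zero_iff)
  have I: "integrable unit_measure (\<lambda>t. ln (cmod (circ t - x)) + ln (cmod (poly q (circ t))))"
    using add integrable_ln_cmod_circ by (auto simp: q_def)
  have "AE t in unit_measure. circ t \<noteq> x" using AE_circ_notin[of "{x}"] by simp
  with AE_poly_circ_neq_0[OF \<open>q \<noteq> 0\<close>]
  have eq: "AE t in unit_measure. ln (cmod (circ t - x)) + ln (cmod (poly q (circ t)))
      = ln (cmod (poly ([:-x, 1:] * q) (circ t)))"
  proof eventually_elim
    case (elim t)
    have "poly ([:-x, 1:] * q) (circ t) = (circ t - x) * poly q (circ t)" by (simp add: algebra_simps)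
    thus ?case using elim by (simp only: norm_mult) (simp add: ln_mult)
  qed
  have J: "integrable unit_measure (\<lambda>t. ln (cmod (poly ([:-x, 1:] * q) (circ t))))"
    by (rule integrable_cong_AE_imp[OF I borel_measurable_ln_cmod_poly eq])
  have "log_mahler ([:-x, 1:] * q)
      = integral\<^sup>L unit_measure (\<lambda>t. ln (cmod (circ t - x)) + ln (cmod (poly q (circ t))))"
    unfolding log_mahler_def 
    by (intro integral_cong_AE borel_measurable_ln_cmod_poly borel_measurable_integrable[OF I])
      (use eq in eventually_elim, simp only:)
  also have "\<dots> = integral\<^sup>L unit_measure (\<lambda>t. ln (cmod (circ t - x))) + log_mahler q"
    unfolding log_mahler_def using add integrable_ln_cmod_circ by (simp add: q_def)
  finally show ?case using J add integral_ln_cmod_circ_le[of x]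
    by (auto simp: q_def simp del: mult_pCons_left)
qed

text \<open>The monic product contributes mean 0 when all its roots lie in the closed disc, leaving
  only the leading coefficient. Reflection of roots brings the later estimates into this
  case.\<close>

lemma
  assumes "p \<noteq> 0"
  shows integrable_ln_cmod_poly: "integrable unit_measure (\<lambda>t. ln (cmod (poly p (circ t))))"
    and log_mahler_roots_in_disc:
      "(\<And>z. norm z > 1 \<Longrightarrow> poly p z \<noteq> 0) \<Longrightarrow> log_mahler p = ln (cmod (lead_coeff p))"
proof -
  obtain A where A: "p = smult (lead_coeff p) (\<Prod>x\<in>#A. [:-x, 1:])"
    using alg_closed_imp_factorization[of p] assms by force
  define q where "q = (\<Prod>x\<in>#A. [:-x, 1:])"
  have pq: "poly p z = lead_coeff p * poly q z" for z unfolding q_def by (subst A) simp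
  have "q \<noteq> 0" by (auto simp: q_def prod_mset_zero_iff)
  have eq: "AE t in unit_measure. ln (cmod (lead_coeff p)) + ln (cmod (poly q (circ t)))
     = ln (cmod (poly p (circ t)))"
    using AE_poly_circ_neq_0[OF \<open>q \<noteq> 0\<close>]
  proof eventually_elim
    case (elim t)
    thus ?case unfolding pq norm_mult using assms by (simp add: ln_mult)
  qed
  have I: "integrable unit_measure (\<lambda>t. ln (cmod (lead_coeff p)) + ln (cmod (poly q (circ t))))"
    using Jensen_prod[of A] by (simp add: q_def)
  thus "integrable unit_measure (\<lambda>t. ln (cmod (poly p (circ t))))"
    by (rule integrable_cong_AE_imp[OF _ borel_measurable_ln_cmod_poly eq])
  assume *: "\<And>z. norm z > 1 \<Longrightarrow> poly p z \<noteq> 0"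
  have "norm x \<le> 1" if "x \<in># A" for x
  proof -
    have "poly q x = 0" using that by (auto simp: q_def poly_prod_mset image_image)
    hence "poly p x = 0" by (simp add: pq)
    thus ?thesis using *[of x] by force
  qed
  hence "log_mahler q = 0" using Jensen_prod[of A] by (auto simp: q_def)
  have "log_mahler p = integral\<^sup>L unit_measure (\<lambda>t. ln (cmod (lead_coeff p)) + ln (cmod (poly q (circ t))))"
    unfolding log_mahler_def 
    by (intro integral_cong_AE borel_measurable_ln_cmod_poly borel_measurable_integrable[OF I])
      (use eq in eventually_elim, simp only:)
  also have "\<dots> = ln (cmod (lead_coeff p)) + log_mahler q"
    unfolding log_mahler_def using Jensen_prod[of A] by (simp add: q_def)
  finally show "log_mahler p = ln (cmod (lead_coeff p))" using \<open>log_mahler q = 0\<close> by simp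
qed

section \<open>Mahler's inequality for the derivative\<close>

lemma log_mahler_mono:
  assumes "p \<noteq> 0" "q \<noteq> 0" "\<And>z. norm z = 1 \<Longrightarrow> cmod (poly p z) \<le> cmod (poly q z)"
  shows "log_mahler p \<le> log_mahler q"
  unfolding log_mahler_def
proof (rule integral_mono_AE)
  show "AE t in unit_measure. ln (cmod (poly p (circ t))) \<le> ln (cmod (poly q (circ t)))"
    using AE_poly_circ_neq_0[OF assms(1)] AE_poly_circ_neq_0[OF assms(2)]
    by eventually_elim (use assms(3) in auto)
qed (use assms integrable_ln_cmod_poly in auto)

theorem log_mahler_pderiv_le:
  assumes "degree p > 0"
  shows "log_mahler (pderiv p) \<le> ln (degree p) + log_mahler p"
proof -
  have p: "p \<noteq> 0" "pderiv p \<noteq> 0" using assms by (auto simp: pderiv_eq_0_iff)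
  obtain q where q: "degree q = degree p" "cmod (lead_coeff p) \<le> cmod (lead_coeff q)"
    "\<And>z. norm z > 1 \<Longrightarrow> poly q z \<noteq> 0"
    "\<And>z. norm z \<ge> 1 \<Longrightarrow> cmod (poly p z) \<le> cmod (poly q z)"
    "\<And>z. norm z = 1 \<Longrightarrow> cmod (poly p z) = cmod (poly q z)"
    using reflect_roots_into_disc[OF p(1)] by metis
  have q0: "q \<noteq> 0" "pderiv q \<noteq> 0" using q(1) assms by (auto simp: pderiv_eq_0_iff)
  have "log_mahler (pderiv p) \<le> log_mahler (pderiv q)"
    using p q0 assms q by (intro log_mahler_mono cmod_pderiv_le_of_dominated) auto
  \<comment> \<open>Gauss-Lucas places the zeros of \<open>pderiv q\<close> in the closed disc, so
    Jensen's formula applies to the derivative as well as to \<open>q\<close>.\<close>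
  also have "\<dots> = ln (cmod (lead_coeff (pderiv q)))"
    using q0 q(1) assms by (intro log_mahler_roots_in_disc Gauss_Lucas_unit_disc q(3)) auto
  also have "cmod (lead_coeff (pderiv q)) = real (degree p) * cmod (lead_coeff q)"
    using q(1) assms by (simp add: degree_pderiv coeff_pderiv norm_mult del: of_nat_Suc)
  also have "ln \<dots> = ln (degree p) + ln (cmod (lead_coeff q))"
    using assms q0 by (simp add: ln_mult)
  also have "ln (cmod (lead_coeff q)) = log_mahler q"
    using q0 q(3) by (intro log_mahler_roots_in_disc[symmetric]) auto
  also have "log_mahler q = log_mahler p" unfolding log_mahler_def using q(5) by simp
  finally show ?thesis by simp
qed

section \<open>Sparse trigonometric polynomials in one variable\<close>

text \<open>Frequencies and coefficients are separate functions of an index, so differentiation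
  rescales \<open>c\<close> while leaving \<open>m\<close> alone.\<close>

definition trig_sum :: "'i set \<Rightarrow> ('i \<Rightarrow> complex) \<Rightarrow> ('i \<Rightarrow> int) \<Rightarrow> real \<Rightarrow> complex" where
  "trig_sum I c m t = (\<Sum>i\<in>I. c i * circ (of_int (m i) * t))"

definition log_mahler_trig :: "'i set \<Rightarrow> ('i \<Rightarrow> complex) \<Rightarrow> ('i \<Rightarrow> int) \<Rightarrow> real" where
  "log_mahler_trig I c m = integral\<^sup>L unit_measure (\<lambda>t. ln (cmod (trig_sum I c m t)))"

text \<open>Multiplication by \<open>circ (- a * t)\<close> clears the negative exponents; meaningful only for \<open>a \<le> m i\<close>,
  since \<open>nat\<close> truncates.\<close>

definition trig_poly :: "'i set \<Rightarrow> ('i \<Rightarrow> complex) \<Rightarrow> ('i \<Rightarrow> int) \<Rightarrow> int \<Rightarrow> complex poly" where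
  "trig_poly I c m a = (\<Sum>i\<in>I. monom (c i) (nat (m i - a)))"

lemma trig_sum_eq_poly:
  assumes "\<forall>i\<in>I. a \<le> m i"
  shows "trig_sum I c m t = circ (of_int a * t) * poly (trig_poly I c m a) (circ t)"
proof -
  have "circ (of_int (m i) * t) = circ (of_int a * t) * circ t ^ nat (m i - a)" if "i \<in> I" for i
  proof -
    have "real (nat (m i - a)) = of_int (m i) - of_int a" using assms that by simp
    thus ?thesis by (simp only: Complex.DeMoivre cis_mult) (simp add: algebra_simps)
  qed
  thus ?thesis
    by (simp add: trig_sum_def trig_poly_def poly_sum poly_monom sum_distrib_left mult_ac)
qed

lemma cmod_trig_sum_eq_poly:
  assumes "\<forall>i\<in>I. a \<le> m i"
  shows "cmod (trig_sum I c m t) = cmod (poly (trig_poly I c m a) (circ t))"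
  using trig_sum_eq_poly[OF assms] by (simp add: norm_mult)

lemma finite_int_bounded_below:
  fixes m :: "'i \<Rightarrow> int"
  assumes "finite I"
  obtains a where "\<forall>i\<in>I. a \<le> m i"
  using that[of "Min (m ` I)"] assms by auto

text \<open>Linear independence of distinct exponentials: after clearing negative exponents one has
  a polynomial vanishing on the whole circle, hence zero, and injectivity of \<open>m\<close>
  isolates each coefficient.\<close>

lemma trig_sum_eq_0_imp:
  assumes "finite I" "inj_on m I" "\<And>t. trig_sum I c m t = 0" "i \<in> I"
  shows "c i = 0"
proof -
  obtain a where a: "\<forall>i\<in>I. a \<le> m i" using finite_int_bounded_below[OF assms(1)] by metis
  let ?p = "trig_poly I c m a"
  have z: "poly ?p (circ t) = 0" for t
    using assms(3)[of t] trig_sum_eq_poly[OF a, of c t] by simp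
  have "?p = 0"
  proof (rule ccontr)
    assume "?p \<noteq> 0"
    from AE_poly_circ_neq_0[OF this] have "AE t in unit_measure. False" using z by simp
    hence "emeasure unit_measure (space unit_measure) = 0"
      by (simp only: eventually_False ae_filter_eq_bot_iff)
    thus False by (simp add: emeasure_restrict_space space_restrict_space)
  qed
  hence "0 = coeff ?p (nat (m i - a))" by simp
  also have "\<dots> = (\<Sum>j\<in>I. if j = i then c j else 0)"
    unfolding trig_poly_def coeff_sum
  proof (intro sum.cong refl)
    fix j assume "j \<in> I"
    hence "nat (m j - a) = nat (m i - a) \<longleftrightarrow> j = i"
      using a \<open>j \<in> I\<close> assms(2,4) by (auto simp: inj_on_def eq_nat_nat_iff)
    thus "coeff (monom (c j) (nat (m j - a))) (nat (m i - a)) = (if j = i then c j else 0)" by simp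
  qed
  also have "\<dots> = c i" using assms(1,4) by simp
  finally show ?thesis by simp
qed

lemma integrable_ln_cmod_trig_sum:
  assumes "finite I" "trig_sum I c m s \<noteq> 0"
  shows "integrable unit_measure (\<lambda>t. ln (cmod (trig_sum I c m t)))"
proof -
  obtain a where a: "\<forall>i\<in>I. a \<le> m i" using finite_int_bounded_below[OF assms(1)] by metis
  have "trig_poly I c m a \<noteq> 0" using assms(2) trig_sum_eq_poly[OF a, of c s] by auto
  from integrable_ln_cmod_poly[OF this] show ?thesis by (simp only: cmod_trig_sum_eq_poly[OF a])
qed

text \<open>The operator \<open>z d/dz\<close>, applied after dividing by \<open>z ^ a\<close>,
  multiplies the coefficient of index \<open>i\<close> by \<open>m i - a\<close>. The extra factor
  \<open>z\<close> has modulus 1 on the circle, and the degree in Mahler's inequality is at most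
  \<open>b - a\<close>.\<close>

lemma log_mahler_trig_lower_deriv:
  assumes "finite I" and a: "\<forall>i\<in>I. a \<le> m i" and b: "\<forall>i\<in>I. m i \<le> b"
    and nz: "trig_sum I (\<lambda>i. of_int (m i - a) * c i) m s \<noteq> 0"
  shows "log_mahler_trig I (\<lambda>i. of_int (m i - a) * c i) m \<le> ln (of_int (b - a)) + log_mahler_trig I c m"
proof -
  let ?p = "trig_poly I c m a"
  have monom: "z * (of_nat n * c * z ^ (n - 1)) = of_nat n * c * z ^ n" for z c :: complex and n
    by (cases n) auto
  have D: "z * poly (pderiv ?p) z = poly (trig_poly I (\<lambda>i. of_int (m i - a) * c i) m a) z" for z
    unfolding trig_poly_def higher_pderiv_sum[of 1, simplified] poly_sum pderiv_monom poly_monom sum_distrib_left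
  proof (intro sum.cong refl)
    fix i assume "i \<in> I"
    hence "of_int (m i - a) = (of_nat (nat (m i - a)) :: complex)" using a by simp
    thus "z * (of_nat (nat (m i - a)) * c i * z ^ (nat (m i - a) - 1))
        = of_int (m i - a) * c i * z ^ nat (m i - a)" by (simp only: monom)
  qed
  have D': "cmod (trig_sum I (\<lambda>i. of_int (m i - a) * c i) m t) = cmod (poly (pderiv ?p) (circ t))" for t
    unfolding cmod_trig_sum_eq_poly[OF a] D[symmetric] by (simp add: norm_mult)
  have "pderiv ?p \<noteq> 0" using D'[of s] nz by auto
  hence deg: "degree ?p > 0" by (auto simp: pderiv_eq_0_iff)
  have "degree ?p \<le> nat (b - a)" unfolding trig_poly_def
  proof (rule degree_sum_le[OF assms(1)])
    fix i assume "i \<in> I"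
    show "degree (monom (c i) (nat (m i - a))) \<le> nat (b - a)"
      using b \<open>i \<in> I\<close> degree_monom_le by (meson diff_right_mono nat_mono order_trans)
  qed
  hence "real (degree ?p) \<le> of_int (b - a)" using deg by linarith
  hence "ln (real (degree ?p)) \<le> ln (of_int (b - a))" using deg by simp
  with log_mahler_pderiv_le[OF deg]
  have "log_mahler (pderiv ?p) \<le> ln (of_int (b - a)) + log_mahler ?p" by linarith
  thus ?thesis by (simp only: log_mahler_trig_def log_mahler_def D' cmod_trig_sum_eq_poly[OF a])
qed

lemma cnj_trig_sum: "cnj (trig_sum I c m t) = trig_sum I (\<lambda>i. cnj (c i)) (\<lambda>i. - m i) t"
  by (simp add: trig_sum_def cis_cnj)

text \<open>Complex conjugation preserves the modulus and negates the frequencies, exchanging the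
  roles of the bounds \<open>a\<close> and \<open>b\<close>.\<close>

lemma log_mahler_trig_upper_deriv:
  assumes "finite I" and a: "\<forall>i\<in>I. a \<le> m i" and b: "\<forall>i\<in>I. m i \<le> b"
    and nz: "trig_sum I (\<lambda>i. of_int (b - m i) * c i) m s \<noteq> 0"
  shows "log_mahler_trig I (\<lambda>i. of_int (b - m i) * c i) m \<le> ln (of_int (b - a)) + log_mahler_trig I c m"
proof -
  have conj: "cmod (trig_sum I (\<lambda>i. cnj (c i)) (\<lambda>i. - m i) t) = cmod (trig_sum I c m t)" for c t
    unfolding cnj_trig_sum[symmetric] by simp
  have *: "(\<lambda>i. of_int (- m i - - b) * cnj (c i)) = (\<lambda>i. cnj (of_int (b - m i) * c i))"
    by (simp add: fun_eq_iff algebra_simps)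
  have "trig_sum I (\<lambda>i. of_int (- m i - - b) * cnj (c i)) (\<lambda>i. - m i) s \<noteq> 0"
    unfolding * using nz conj by (metis norm_eq_zero)
  with assms have "log_mahler_trig I (\<lambda>i. of_int (- m i - - b) * cnj (c i)) (\<lambda>i. - m i)
      \<le> ln (of_int (- a - - b)) + log_mahler_trig I (\<lambda>i. cnj (c i)) (\<lambda>i. - m i)"
    by (intro log_mahler_trig_lower_deriv) auto
  thus ?thesis unfolding * log_mahler_trig_def conj by simp
qed

text \<open>Each differentiation costs a factor given by the width of the spectrum. The weights
  gained in return add up to the same width, so the constant depends on the number of terms and not
  on the degree.\<close>

theorem sparse_coeff_bound:
  fixes c :: "nat \<Rightarrow> complex" and m :: "nat \<Rightarrow> int"
  assumes "strict_mono_on {0..N} m" "\<exists>n\<le>N. c n \<noteq> 0" "n \<le> N"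
  shows "cmod (c n) \<le> real (N choose n) * exp (log_mahler_trig {0..N} c m)"
  using assms
proof (induction N arbitrary: c m n)
  case 0
  hence "c 0 \<noteq> 0" "n = 0" by auto
  thus ?case by (simp add: log_mahler_trig_def trig_sum_def norm_mult)
next
  case (Suc N)
  define w where "w = m (Suc N) - m 0"
  define L where "L = exp (log_mahler_trig {0..Suc N} c m)"
  have mono: "m i < m j" if "i < j" "j \<le> Suc N" for i j
    using Suc.prems(1) that by (auto simp: strict_mono_on_def)
  have monole: "m i \<le> m j" if "i \<le> j" "j \<le> Suc N" for i j
    using mono[of i j] that by (cases "i = j") auto
  have "w > 0" using mono[of 0 "Suc N"] by (simp add: w_def)
  have inj: "inj_on m {0..Suc N}" using Suc.prems(1) by (rule strict_mono_on_imp_inj_on)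
  have exp_le: "exp x \<le> of_int w * L" if "x \<le> ln (of_int w) + log_mahler_trig {0..Suc N} c m" for x
  proof -
    have "exp x \<le> exp (ln (of_int w) + log_mahler_trig {0..Suc N} c m)" using that by simp
    thus ?thesis using \<open>w > 0\<close> by (simp add: exp_add L_def)
  qed
  \<comment> \<open>The conditional encodes "N choose -1 = 0" for Pascal's rule; truncated
    subtraction alone would give \<open>N choose 0\<close> at \<open>n = 0\<close>.\<close>
  have lower: "of_int (m n - m 0) * cmod (c n) \<le> (if n = 0 then 0 else real (N choose (n - 1))) * (of_int w * L)"
  proof (cases n)
    case (Suc j)
    define d where "d i = of_int (m i - m 0) * c i" for i
    have norm_d: "cmod (d i) = of_int (m i - m 0) * cmod (c i)" if "i \<le> Suc N" for i
      unfolding d_def norm_mult norm_of_int using monole[of 0 i] that by simp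
    \<comment> \<open>\<open>d 0 = 0\<close>, so the lowest term disappears and reindexing leaves a
      sum to which the induction hypothesis applies.\<close>
    have shift: "trig_sum {0..N} (\<lambda>i. d (Suc i)) (\<lambda>i. m (Suc i)) = trig_sum {0..Suc N} d m"
      unfolding trig_sum_def sum.atLeast0_atMost_Suc_shift by (simp add: d_def fun_eq_iff)
    show ?thesis
    proof (cases "c n = 0")
      case True
      thus ?thesis using \<open>w > 0\<close> by (simp add: L_def)
    next
      case False
      \<comment> \<open>A nonzero \<open>d n\<close> provides both a point where the differentiated
        sum is nonzero and the nontriviality assumption of the induction hypothesis.\<close>
      hence dn: "d n \<noteq> 0" using Suc mono[of 0 n] Suc.prems(3) by (auto simp: d_def)
      then obtain s where "trig_sum {0..Suc N} d m s \<noteq> 0"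
        using trig_sum_eq_0_imp[OF _ inj, of d n] Suc.prems(3) by auto
      hence le: "log_mahler_trig {0..Suc N} d m \<le> ln (of_int w) + log_mahler_trig {0..Suc N} c m"
        unfolding d_def w_def by (intro log_mahler_trig_lower_deriv) (auto intro: monole)
      have "cmod (d (Suc j)) \<le> real (N choose j) * exp (log_mahler_trig {0..N} (\<lambda>i. d (Suc i)) (\<lambda>i. m (Suc i)))"
        using dn Suc Suc.prems(3)
        by (intro Suc.IH) (auto simp: strict_mono_on_def intro!: mono)
      also have "\<dots> \<le> real (N choose j) * (of_int w * L)"
        using le by (intro mult_left_mono exp_le) (auto simp: log_mahler_trig_def shift)
      finally show ?thesis using norm_d[of n] Suc Suc.prems(3) by simp
    qed
  qed simp
  have upper: "of_int (m (Suc N) - m n) * cmod (c n) \<le> real (N choose n) * (of_int w * L)"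
  proof (cases "n = Suc N")
    case False
    hence n: "n \<le> N" using Suc.prems(3) by simp
    define d where "d i = of_int (m (Suc N) - m i) * c i" for i
    have norm_d: "cmod (d i) = of_int (m (Suc N) - m i) * cmod (c i)" if "i \<le> Suc N" for i
      unfolding d_def norm_mult norm_of_int using monole[of i "Suc N"] that by simp
    \<comment> \<open>Now \<open>d (Suc N) = 0\<close>, so the highest term drops out and the
      indices stay as they are.\<close>
    have shift: "trig_sum {0..N} d m = trig_sum {0..Suc N} d m"
      by (simp add: trig_sum_def d_def fun_eq_iff)
    show ?thesis
    proof (cases "c n = 0")
      case True
      thus ?thesis using \<open>w > 0\<close> by (simp add: L_def)
    next
      case False
      hence dn: "d n \<noteq> 0" using mono[of n "Suc N"] n by (auto simp: d_def)
      then obtain s where "trig_sum {0..Suc N} d m s \<noteq> 0"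
        using trig_sum_eq_0_imp[OF _ inj, of d n] Suc.prems(3) by auto
      hence le: "log_mahler_trig {0..Suc N} d m \<le> ln (of_int w) + log_mahler_trig {0..Suc N} c m"
        unfolding d_def w_def by (intro log_mahler_trig_upper_deriv) (auto intro: monole)
      have "cmod (d n) \<le> real (N choose n) * exp (log_mahler_trig {0..N} d m)"
        using dn n by (intro Suc.IH) (auto simp: strict_mono_on_def intro!: mono)
      also have "\<dots> \<le> real (N choose n) * (of_int w * L)"
        using le by (intro mult_left_mono exp_le) (auto simp: log_mahler_trig_def shift)
      finally show ?thesis using norm_d[of n] n by simp
    qed
  qed (simp add: binomial_eq_0)
  \<comment> \<open>The two weights sum to \<open>w\<close>; after Pascal's rule this positive
    factor cancels.\<close>
  have "of_int w * cmod (c n) = of_int (m n - m 0) * cmod (c n) + of_int (m (Suc N) - m n) * cmod (c n)"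
    by (simp add: w_def algebra_simps)
  also have "\<dots> \<le> (if n = 0 then 0 else real (N choose (n - 1))) * (of_int w * L)
      + real (N choose n) * (of_int w * L)"
    using lower upper by (rule add_mono)
  also have "\<dots> = of_int w * (real (Suc N choose n) * L)"
    by (cases n) (auto simp: algebra_simps)
  finally show ?case using \<open>w > 0\<close> unfolding L_def by simp
qed

section \<open>Translation and characters on the torus\<close>

abbreviation cube_measure :: "(real ^ 'm) measure" where
  "cube_measure \<equiv> restrict_space lborel (cbox 0 1)"

abbreviation ivec :: "int ^ 'm \<Rightarrow> real ^ 'm" where
  "ivec l \<equiv> \<chi> i. real_of_int (l $ i)"

lemma emeasure_cube [simp]: "emeasure lborel (cbox 0 1 :: (real ^ 'm) set) = 1"
proof -
  have "(1 - 0 :: real ^ 'm) \<bullet> b = 1" if "b \<in> Basis" for b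
    using that by (auto simp: Basis_vec_def inner_axis)
  thus ?thesis by (subst emeasure_lborel_cbox) auto
qed

lemma finite_measure_cube: "finite_measure cube_measure"
  by (rule finite_measureI) (simp add: emeasure_restrict_space space_restrict_space)

lemma measure_cube [simp]: "measure cube_measure (cbox 0 1 :: (real ^ 'm) set) = 1"
  by (simp add: measure_def emeasure_restrict_space)

text \<open>An exact fundamental domain for the integer lattice: translates of the closed cube would
  overlap on their faces.\<close>

definition half_open_cube :: "(real ^ 'm) set" where
  "half_open_cube = {x. \<forall>i. 0 \<le> x $ i \<and> x $ i < 1}"

lemma half_open_cube_borel [measurable]: "half_open_cube \<in> sets borel"
  unfolding half_open_cube_def by measurable

text \<open>The componentwise floor determines the only translate containing \<open>v\<close>.
  Writing the sum as an integral over counting measure allows it to be inserted as a factor 1 and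
  exchanged with another integral.\<close>

lemma half_open_cube_tiling:
  fixes v :: "real ^ 'm"
  shows "(\<integral>\<^sup>+l. indicator half_open_cube (v - ivec l) \<partial>count_space UNIV) = (1 :: ennreal)"
    and "(\<integral>\<^sup>+l. indicator half_open_cube (v + ivec l) \<partial>count_space UNIV) = (1 :: ennreal)"
proof -
  have "indicator half_open_cube (v - ivec l) = (indicator {\<chi> i. \<lfloor>v $ i\<rfloor>} l :: ennreal)" for l
  proof -
    have "l $ i = \<lfloor>v $ i\<rfloor> \<longleftrightarrow> 0 \<le> v $ i - l $ i \<and> v $ i - l $ i < 1" for i
      using floor_eq_iff[of "v $ i" "l $ i"] by (auto simp: algebra_simps)
    thus ?thesis by (simp add: half_open_cube_def vec_eq_iff split: split_indicator)
  qed
  thus "(\<integral>\<^sup>+l. indicator half_open_cube (v - ivec l) \<partial>count_space UNIV) = (1 :: ennreal)" by simp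
  have "indicator half_open_cube (v + ivec l) = (indicator {\<chi> i. - \<lfloor>v $ i\<rfloor>} l :: ennreal)" for l
  proof -
    have "l $ i = - \<lfloor>v $ i\<rfloor> \<longleftrightarrow> 0 \<le> v $ i + l $ i \<and> v $ i + l $ i < 1" for i
      using floor_eq_iff[of "v $ i" "- l $ i"] by (auto simp: algebra_simps)
    thus ?thesis by (simp add: half_open_cube_def vec_eq_iff split: split_indicator)
  qed
  thus "(\<integral>\<^sup>+l. indicator half_open_cube (v + ivec l) \<partial>count_space UNIV) = (1 :: ennreal)" by simp
qed

lemma nn_integral_lborel_translate:
  fixes f :: "'a :: euclidean_space \<Rightarrow> ennreal"
  assumes [measurable]: "f \<in> borel_measurable borel"
  shows "(\<integral>\<^sup>+x. f (x + c) \<partial>lborel) = (\<integral>\<^sup>+x. f x \<partial>lborel)"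
proof -
  have "(\<integral>\<^sup>+x. f x \<partial>lborel) = (\<integral>\<^sup>+x. f x \<partial>distr lborel borel ((+) c))" by (simp add: lborel_distr_plus)
  also have "\<dots> = (\<integral>\<^sup>+x. f (c + x) \<partial>lborel)" by (subst nn_integral_distr) auto
  finally show ?thesis by (simp add: add.commute)
qed

text \<open>The two cubes differ only on the hyperplanes where some coordinate is 1, which are
  null.\<close>

lemma nn_integral_cube_half_open:
  fixes g :: "real ^ 'm \<Rightarrow> ennreal"
  shows "(\<integral>\<^sup>+x. g x \<partial>cube_measure) = (\<integral>\<^sup>+x. g x * indicator half_open_cube x \<partial>lborel)"
proof -
  have "AE x :: real ^ 'm in lborel. \<forall>i\<in>UNIV. x $ i \<noteq> 1"
  proof (rule eventually_ball_finite; safe?)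
    fix i :: 'm
    have "AE x :: real ^ 'm in lborel. x \<bullet> axis i 1 \<noteq> 1"
      by (rule AE_lborel_inner_neq) (auto simp: axis_in_Basis_iff)
    thus "AE x :: real ^ 'm in lborel. x $ i \<noteq> 1" by (simp add: inner_axis)
  qed auto
  hence "AE x in lborel. (indicator (cbox 0 1) x :: ennreal) = indicator half_open_cube (x :: real ^ 'm)"
    by eventually_elim (auto simp: half_open_cube_def mem_box_cart less_le split: split_indicator)
  hence "AE x in lborel. g x * indicator (cbox 0 1) x = g x * indicator half_open_cube x"
    by eventually_elim simp
  hence "(\<integral>\<^sup>+x. g x * indicator (cbox 0 1) x \<partial>lborel) = (\<integral>\<^sup>+x. g x * indicator half_open_cube x \<partial>lborel)"
    by (rule nn_integral_cong_AE)
  thus ?thesis by (subst nn_integral_restrict_space) auto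
qed

text \<open>Both the cube and its translate are fundamental domains for the integer lattice.\<close>

lemma nn_integral_cube_translate:
  fixes g :: "real ^ 'm \<Rightarrow> ennreal"
  assumes [measurable]: "g \<in> borel_measurable borel"
    and per: "\<And>x l. g (x + ivec l) = g x"
  shows "(\<integral>\<^sup>+x. g (x + y) \<partial>cube_measure) = (\<integral>\<^sup>+x. g x \<partial>cube_measure)"
proof -
  let ?C = "half_open_cube :: (real ^ 'm) set"
  have "(\<integral>\<^sup>+x. g (x + y) \<partial>cube_measure) = (\<integral>\<^sup>+x. g (x + y) * indicator ?C (x + y - y) \<partial>lborel)"
    by (simp add: nn_integral_cube_half_open)
  also have "\<dots> = (\<integral>\<^sup>+x. g x * indicator ?C (x - y) \<partial>lborel)"
    by (rule nn_integral_lborel_translate) measurable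
  \<comment> \<open>Cuts the translated cube into its pieces in the lattice translates of the
    standard cube.\<close>
  also have "\<dots> = (\<integral>\<^sup>+x. \<integral>\<^sup>+l. g x * indicator ?C (x - y) * indicator ?C (x - ivec l) \<partial>count_space UNIV \<partial>lborel)"
    by (simp add: nn_integral_cmult half_open_cube_tiling)
  also have "\<dots> = (\<integral>\<^sup>+l. \<integral>\<^sup>+x. g x * indicator ?C (x - y) * indicator ?C (x - ivec l) \<partial>lborel \<partial>count_space UNIV)"
    by (intro nn_integral_count_space_nn_integral) auto
  \<comment> \<open>Each piece is moved back into the standard cube by a lattice vector, under which
    \<open>g\<close> is periodic.\<close>
  also have "\<dots> = (\<integral>\<^sup>+l. \<integral>\<^sup>+x. g x * indicator ?C (x - y + ivec l) * indicator ?C x \<partial>lborel \<partial>count_space UNIV)"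
  proof (rule nn_integral_cong)
    fix l :: "int ^ 'm"
    have "(\<integral>\<^sup>+x. g x * indicator ?C (x - y) * indicator ?C (x - ivec l) \<partial>lborel)
       = (\<integral>\<^sup>+x. g (x + ivec l) * indicator ?C (x + ivec l - y) * indicator ?C (x + ivec l - ivec l) \<partial>lborel)"
      by (rule nn_integral_lborel_translate[symmetric]) measurable
    thus "(\<integral>\<^sup>+x. g x * indicator ?C (x - y) * indicator ?C (x - ivec l) \<partial>lborel)
       = (\<integral>\<^sup>+x. g x * indicator ?C (x - y + ivec l) * indicator ?C x \<partial>lborel)"
      by (simp add: per algebra_simps)
  qed
  \<comment> \<open>After summing over \<open>l\<close> again, the translates of the shifted cube
    tile the space and leave only the standard cube.\<close>
  also have "\<dots> = (\<integral>\<^sup>+x. \<integral>\<^sup>+l. g x * indicator ?C (x - y + ivec l) * indicator ?C x \<partial>count_space UNIV \<partial>lborel)"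
    by (intro nn_integral_count_space_nn_integral[symmetric]) auto
  also have "\<dots> = (\<integral>\<^sup>+x. g x * indicator ?C x \<partial>lborel)"
    by (simp add: nn_integral_cmult nn_integral_multc half_open_cube_tiling)
  finally show ?thesis by (simp add: nn_integral_cube_half_open)
qed

section \<open>Characters, Fourier coefficients and integer directions\<close>

lemma int_dot_add: "int_dot k (x + y) = int_dot k x + int_dot k y"
  by (simp add: int_dot_def algebra_simps sum.distrib)

lemma int_dot_diff_left: "int_dot (k - j) x = int_dot k x - int_dot j x"
  by (simp add: int_dot_def algebra_simps sum_subtractf)

lemma torus_char_cis: "torus_char k x = circ (int_dot k x)"
  by (simp add: torus_char_def cis_conv_exp mult_ac)

lemma norm_torus_char [simp]: "norm (torus_char k x) = 1"
  by (simp add: torus_char_cis)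

lemma torus_char_add: "torus_char k (x + y) = torus_char k x * torus_char k y"
  by (simp add: torus_char_cis int_dot_add cis_mult algebra_simps)

lemma continuous_on_torus_char [continuous_intros]: "continuous_on A (torus_char k)"
  unfolding torus_char_def int_dot_def by (intro continuous_intros)

lemma borel_measurable_torus_char [measurable]: "torus_char k \<in> borel_measurable borel"
  by (intro borel_measurable_continuous_onI continuous_intros)

lemma borel_measurable_cube:
  "f \<in> borel_measurable borel \<Longrightarrow> f \<in> borel_measurable cube_measure"
  by (intro measurable_restrict_space1) simp

lemma integrable_torus_char: "integrable cube_measure (torus_char k)"
  using finite_measure_cube
  by (intro finite_measure.integrable_const_bound[where B = 1] borel_measurable_cube) auto

lemma integral_torus_char:
  fixes k :: "int ^ 'm"
  shows "integral\<^sup>L cube_measure (torus_char k) = (if k = 0 then 1 else 0)"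
proof (cases "k = 0")
  case True
  hence "torus_char k = (\<lambda>_. 1)" by (simp add: torus_char_cis int_dot_def fun_eq_iff)
  thus ?thesis using True by (simp add: space_restrict_space)
next
  case False
  then obtain i where i: "k $ i \<noteq> 0" by (auto simp: vec_eq_iff)
  \<comment> \<open>A half period in a coordinate where \<open>k\<close> is nonzero, chosen so that
    \<open>int_dot k y = 1 / 2\<close>.\<close>
  define y :: "real ^ 'm" where "y = axis i (1 / (2 * real_of_int (k $ i)))"
  have "int_dot k y = (\<Sum>j\<in>UNIV. if j = i then 1 / 2 else 0)"
    unfolding int_dot_def y_def using i by (intro sum.cong) (auto simp: axis_def)
  hence half: "int_dot k y = 1 / 2" by simp
  have "torus_char k y = -1" unfolding torus_char_cis half by simp
  \<comment> \<open>Translation by \<open>y\<close> flips the sign of the character but preserves its integral.\<close>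
  hence flip: "torus_char k (x + y) = - torus_char k x" for x
    by (simp add: torus_char_add)
  \<comment> \<open>Translation invariance is available for nonnegative integrands, so the odd
    functions \<open>Re\<close> and \<open>Im\<close> are treated through \<open>1 + h\<close> and
    \<open>1 - h\<close>; the shift by \<open>y\<close> exchanges these two.\<close>
  have zero: "integral\<^sup>L cube_measure (\<lambda>x. h (torus_char k x)) = 0"
    if h [measurable]: "h \<in> borel_measurable borel" and b: "\<And>z. \<bar>h z\<bar> \<le> norm z"
      and neg: "\<And>z. h (- z) = - h z" for h :: "complex \<Rightarrow> real"
  proof -
    have bd: "0 \<le> 1 + h (torus_char k x)" "0 \<le> 1 - h (torus_char k x)" for x
      using b[of "torus_char k x"] by auto
    have I: "integrable cube_measure (\<lambda>x. h (torus_char k x))"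
      using finite_measure_cube b[of "torus_char k _"]
      by (intro finite_measure.integrable_const_bound[where B = 1] borel_measurable_cube) auto
    have "(\<integral>\<^sup>+x. ennreal (1 + h (torus_char k (x + y))) \<partial>cube_measure)
        = (\<integral>\<^sup>+x. ennreal (1 + h (torus_char k x)) \<partial>cube_measure)"
      by (rule nn_integral_cube_translate) (measurable, simp add: torus_char_periodic)
    hence "(\<integral>\<^sup>+x. ennreal (1 - h (torus_char k x)) \<partial>cube_measure)
        = (\<integral>\<^sup>+x. ennreal (1 + h (torus_char k x)) \<partial>cube_measure)" by (simp add: flip neg)
    hence "integral\<^sup>L cube_measure (\<lambda>x. 1 - h (torus_char k x))
        = integral\<^sup>L cube_measure (\<lambda>x. 1 + h (torus_char k x))"
      using bd by (subst (1 2) integral_eq_nn_integral) (auto intro!: borel_measurable_cube)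
    moreover have one: "integrable cube_measure (\<lambda>_::real ^ 'm. 1::real)"
      using finite_measure.integrable_const[OF finite_measure_cube] .
    ultimately show ?thesis
      by (simp only: Bochner_Integration.integral_diff[OF one I] Bochner_Integration.integral_add[OF one I])
  qed
  have "Re (integral\<^sup>L cube_measure (torus_char k)) = 0" "Im (integral\<^sup>L cube_measure (torus_char k)) = 0"
    using zero[of Re] zero[of Im] integrable_torus_char[of k]
    by (auto simp: abs_Re_le_cmod abs_Im_le_cmod)
  thus ?thesis using False by (simp add: complex_eq_iff)
qed

text \<open>Multiplication by the conjugate character shifts every frequency by \<open>- j\<close>,
  and only the trivial character has a nonzero integral.\<close>

lemma fourier_coeff_sum:
  assumes "finite T" "\<And>x. F x = (\<Sum>k\<in>T. c k * torus_char k x)"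
  shows "fourier_coeff F j = (if j \<in> T then c j else 0)"
proof -
  have "F x * exp (- (2 * of_real pi * \<i> * of_real (int_dot j x))) = (\<Sum>k\<in>T. c k * torus_char (k - j) x)" for x
  proof -
    have "exp (- (2 * of_real pi * \<i> * of_real (int_dot j x))) = circ (- int_dot j x)"
      by (simp add: cis_conv_exp mult_ac)
    moreover have "torus_char k x * circ (- int_dot j x) = torus_char (k - j) x" for k
      unfolding torus_char_cis cis_mult by (simp add: int_dot_diff_left right_diff_distrib)
    ultimately show ?thesis by (simp only: assms(2) sum_distrib_right mult.assoc)
  qed
  hence "fourier_coeff F j = integral\<^sup>L cube_measure (\<lambda>x. \<Sum>k\<in>T. c k * torus_char (k - j) x)"
    by (simp add: fourier_coeff_def set_lebesgue_integral_def integral_restrict_space)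
  also have "\<dots> = (\<Sum>k\<in>T. c k * (if k - j = 0 then 1 else 0))"
    by (simp add: integrable_torus_char integral_torus_char)
  also have "\<dots> = (\<Sum>k\<in>T. if k = j then c k else 0)"
    by (intro sum.cong) auto
  also have "\<dots> = (if j \<in> T then c j else 0)" using assms(1) by simp
  finally show ?thesis .
qed

text \<open>Rounding each coordinate of \<open>q * \<alpha>\<close> changes the pairing with
  \<open>d\<close> by a bounded amount, while the unrounded pairing grows linearly in
  \<open>q\<close>.\<close>

lemma eventually_int_dot_floor_pos:
  fixes d :: "int ^ 'm"
  assumes "int_dot d \<alpha> > 0"
  shows "\<forall>\<^sub>F q in sequentially. (\<Sum>i\<in>UNIV. d $ i * \<lfloor>real q * \<alpha> $ i\<rfloor>) > 0"
proof -
  define K where "K = (\<Sum>i\<in>UNIV. \<bar>real_of_int (d $ i)\<bar>)"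
  have "filterlim (\<lambda>q. int_dot d \<alpha> * real q) at_top sequentially"
    using assms by (intro filterlim_tendsto_pos_mult_at_top[OF tendsto_const] filterlim_real_sequentially)
  hence "\<forall>\<^sub>F q in sequentially. int_dot d \<alpha> * real q > K" by (simp add: filterlim_at_top_dense)
  thus ?thesis
  proof eventually_elim
    case (elim q)
    have "K \<ge> (\<Sum>i\<in>UNIV. d $ i * (real q * \<alpha> $ i) - d $ i * \<lfloor>real q * \<alpha> $ i\<rfloor>)"
      unfolding K_def
    proof (rule sum_mono)
      fix i
      have "d $ i * (real q * \<alpha> $ i) - d $ i * \<lfloor>real q * \<alpha> $ i\<rfloor> \<le> \<bar>real_of_int (d $ i)\<bar> * \<bar>real q * \<alpha> $ i - \<lfloor>real q * \<alpha> $ i\<rfloor>\<bar>"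
        unfolding abs_mult[symmetric] by (simp add: algebra_simps)
      also have "\<dots> \<le> \<bar>real_of_int (d $ i)\<bar> * 1"
        by (intro mult_left_mono) linarith+
      finally show "d $ i * (real q * \<alpha> $ i) - d $ i * \<lfloor>real q * \<alpha> $ i\<rfloor> \<le> \<bar>real_of_int (d $ i)\<bar>" by simp
    qed
    moreover have "(\<Sum>i\<in>UNIV. d $ i * (real q * \<alpha> $ i)) = int_dot d \<alpha> * real q"
      unfolding int_dot_def sum_distrib_right by (intro sum.cong) auto
    ultimately have "real_of_int (\<Sum>i\<in>UNIV. d $ i * \<lfloor>real q * \<alpha> $ i\<rfloor>) > 0"
      using elim by (simp add: sum_subtractf)
    thus ?case by linarith
  qed
qed

text \<open>The ordering amounts to finitely many strict inequalities, so a single large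
  \<open>q\<close> preserves all of them after \<open>q * \<alpha>\<close> is rounded down.\<close>

lemma integer_direction_preserving_order:
  fixes k :: "nat \<Rightarrow> int ^ 'm"
  assumes "strict_mono_on {0..N} (\<lambda>n. int_dot (k n) \<alpha>)"
  obtains a :: "int ^ 'm" where "strict_mono_on {0..N} (\<lambda>n. \<Sum>i\<in>UNIV. k n $ i * a $ i)"
proof -
  define P where "P = {(m, n). m \<in> {0..N} \<and> n \<in> {0..N} \<and> m < n}"
  have "P \<subseteq> {0..N} \<times> {0..N}" by (auto simp: P_def)
  hence "finite P" by (rule finite_subset) simp
  hence "\<forall>\<^sub>F q in sequentially. \<forall>(m, n)\<in>P. (\<Sum>i\<in>UNIV. (k n - k m) $ i * \<lfloor>real q * \<alpha> $ i\<rfloor>) > 0"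
  proof (rule eventually_ball_finite, safe)
    fix m n assume "(m, n) \<in> P"
    hence "int_dot (k n - k m) \<alpha> > 0"
      using assms by (auto simp: P_def int_dot_diff_left strict_mono_on_def)
    thus "\<forall>\<^sub>F q in sequentially. (\<Sum>i\<in>UNIV. (k n - k m) $ i * \<lfloor>real q * \<alpha> $ i\<rfloor>) > 0"
      by (rule eventually_int_dot_floor_pos)
  qed
  then obtain q :: nat where q: "\<forall>(m, n)\<in>P. (\<Sum>i\<in>UNIV. (k n - k m) $ i * \<lfloor>real q * \<alpha> $ i\<rfloor>) > 0"
    using eventually_happens'[OF sequentially_bot] by blast
  define a :: "int ^ 'm" where "a = (\<chi> i. \<lfloor>real q * \<alpha> $ i\<rfloor>)"
  have "strict_mono_on {0..N} (\<lambda>n. \<Sum>i\<in>UNIV. k n $ i * a $ i)"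
  proof (rule strict_mono_onI)
    fix m n assume "m \<in> {0..N}" "n \<in> {0..N}" "m < n"
    with q have "(\<Sum>i\<in>UNIV. (k n - k m) $ i * a $ i) > 0" by (auto simp: P_def a_def)
    thus "(\<Sum>i\<in>UNIV. k m $ i * a $ i) < (\<Sum>i\<in>UNIV. k n $ i * a $ i)"
      by (simp add: left_diff_distrib sum_subtractf)
  qed
  thus ?thesis by (rule that)
qed

section \<open>The bound on the torus\<close>

text \<open>The summand 1 keeps the right-hand side nonnegative, so the bound survives the default
  \<open>ln 0 = 0\<close>.\<close>

lemma ln_cmod_le:
  assumes "cmod z \<le> B" "0 \<le> B"
  shows "ln (cmod z) \<le> ln (1 + B)"
  using assms by (cases "z = 0") (auto intro: ln_ge_zero)

text \<open>The one-variable bound holds uniformly on every line in the direction \<open>a\<close>; averaging it over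
  all starting points yields the bound on the torus, and the integrability of \<open>ln (cmod (F x))\<close>.\<close>

lemma mahler_measure_coeff_bound:
  fixes F :: "real ^ 'm \<Rightarrow> complex" and k :: "nat \<Rightarrow> int ^ 'm" and a :: "int ^ 'm"
  assumes F: "\<And>x. F x = (\<Sum>n\<in>{0..N}. c n * torus_char (k n) x)"
    and mono: "strict_mono_on {0..N} (\<lambda>n. \<Sum>i\<in>UNIV. k n $ i * a $ i)"
    and n: "n \<le> N"
  shows "cmod (c n) \<le> real (N choose n) * mahler_measure F"
proof (cases "c n = 0")
  case False
  define m where "m n = (\<Sum>i\<in>UNIV. k n $ i * a $ i)" for n
  \<comment> \<open>An upper bound for \<open>ln (cmod (F x))\<close>. It makes \<open>g\<close>
    nonnegative, so that Tonelli applies before integrability is known.\<close>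
  define K where "K = ln (1 + (\<Sum>n\<in>{0..N}. cmod (c n)))"
  define g where "g x = K - ln (cmod (F x))" for x
  \<comment> \<open>The desired inequality for the mean of \<open>ln (cmod (F x))\<close>, rewritten
    as an upper bound for the mean of \<open>g\<close>.\<close>
  define B where "B = K - (ln (cmod (c n)) - ln (real (N choose n)))"
  have [measurable]: "F \<in> borel_measurable borel" unfolding F[abs_def] by measurable
  have g_meas [measurable]: "g \<in> borel_measurable borel" unfolding g_def by measurable
  have g_nonneg: "g x \<ge> 0" for x
  proof -
    have "cmod (F x) \<le> (\<Sum>n\<in>{0..N}. cmod (c n))"
      unfolding F by (rule sum_norm_le) (simp add: norm_mult)
    from ln_cmod_le[OF this] show ?thesis by (simp add: g_def K_def sum_nonneg)
  qed
  have binom: "real (N choose n) > 0" using n by simp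
  \<comment> \<open>Along a line the starting point enters only through unimodular factors of the
    coefficients, and the frequencies become the integers \<open>m n\<close>.\<close>
  have line: "F (x + t *\<^sub>R ivec a) = trig_sum {0..N} (\<lambda>n. c n * torus_char (k n) x) m t" for x t
  proof -
    have "int_dot (k n) (t *\<^sub>R ivec a) = of_int (m n) * t" for n
      unfolding int_dot_def m_def of_int_sum sum_distrib_right by (intro sum.cong) auto
    thus ?thesis
      by (simp add: F trig_sum_def torus_char_add torus_char_cis[of _ "t *\<^sub>R _"] mult_ac)
  qed
  have on_line: "(\<integral>\<^sup>+t. ennreal (g (x + t *\<^sub>R ivec a)) \<partial>unit_measure) \<le> ennreal B" for x
  proof -
    let ?c = "\<lambda>n. c n * torus_char (k n) x"
    have "torus_char (k n) x \<noteq> 0" by (metis norm_torus_char norm_zero zero_neq_one)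
    hence cn: "cmod (?c n) = cmod (c n)" "?c n \<noteq> 0"
      using False by (auto simp: norm_mult)
    have m_mono: "strict_mono_on {0..N} m" using mono by (simp add: m_def[abs_def])
    hence inj: "inj_on m {0..N}" by (rule strict_mono_on_imp_inj_on)
    obtain s where "trig_sum {0..N} ?c m s \<noteq> 0"
      using trig_sum_eq_0_imp[OF _ inj, of ?c n] cn(2) n by auto
    from integrable_ln_cmod_trig_sum[OF _ this]
    have I: "integrable unit_measure (\<lambda>t. ln (cmod (F (x + t *\<^sub>R ivec a))))" by (simp add: line)
    have "cmod (c n) \<le> real (N choose n) * exp (log_mahler_trig {0..N} ?c m)"
      using sparse_coeff_bound[OF m_mono _ n, of ?c] cn n by auto
    hence "ln (cmod (c n)) \<le> ln (real (N choose n) * exp (log_mahler_trig {0..N} ?c m))"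
      using False by (intro ln_mono) auto
    also have "\<dots> = ln (real (N choose n)) + log_mahler_trig {0..N} ?c m"
      using binom by (subst ln_mult) auto
    finally have L: "K - log_mahler_trig {0..N} ?c m \<le> B" by (simp add: B_def)
    have "(\<integral>\<^sup>+t. ennreal (g (x + t *\<^sub>R ivec a)) \<partial>unit_measure)
        = ennreal (integral\<^sup>L unit_measure (\<lambda>t. g (x + t *\<^sub>R ivec a)))"
      using I g_nonneg by (intro nn_integral_eq_integral) (auto simp: g_def)
    also have "integral\<^sup>L unit_measure (\<lambda>t. g (x + t *\<^sub>R ivec a)) = K - log_mahler_trig {0..N} ?c m"
      using I by (simp add: g_def log_mahler_trig_def line)
    finally show ?thesis using L by (simp add: ennreal_leI)
  qed
  have per: "g (x + ivec l) = g x" for x l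
    by (simp add: g_def F torus_char_periodic)
  interpret pair_sigma_finite "cube_measure :: (real ^ 'm) measure" unit_measure
    using finite_measure_cube finite_measure_unit
    by (intro pair_sigma_finite.intro finite_measure.axioms(1)) 
  have [measurable]: "(\<lambda>x. x) \<in> measurable (cube_measure :: (real ^ 'm) measure) borel"
    "(\<lambda>t. t) \<in> measurable unit_measure borel"
    by (intro measurable_restrict_space1; simp)+
  have [measurable]: "fst \<in> measurable ((cube_measure :: (real ^ 'm) measure) \<Otimes>\<^sub>M unit_measure) borel"
    "snd \<in> measurable ((cube_measure :: (real ^ 'm) measure) \<Otimes>\<^sub>M unit_measure) borel"
    by (rule measurable_compose[OF measurable_fst] measurable_compose[OF measurable_snd]; measurable)+
  \<comment> \<open>Averaging a constant over \<open>t\<close> in [0,1] introduces the line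
    parameter. For each fixed \<open>t\<close>, translation invariance then replaces
    \<open>x\<close> by a point on the line, and Tonelli makes the integral along the line the inner
    one.\<close>
  have "(\<integral>\<^sup>+x. ennreal (g x) \<partial>cube_measure)
      = (\<integral>\<^sup>+t. (\<integral>\<^sup>+x. ennreal (g x) \<partial>(cube_measure :: (real ^ 'm) measure)) \<partial>unit_measure)"
    by (simp add: emeasure_restrict_space space_restrict_space)
  also have "\<dots> = (\<integral>\<^sup>+t. (\<integral>\<^sup>+x. ennreal (g (x + t *\<^sub>R ivec a)) \<partial>(cube_measure :: (real ^ 'm) measure)) \<partial>unit_measure)"
    by (intro nn_integral_cong nn_integral_cube_translate[symmetric]) (simp_all add: per)
  also have "\<dots> = (\<integral>\<^sup>+x. (\<integral>\<^sup>+t. ennreal (g (x + t *\<^sub>R ivec a)) \<partial>unit_measure) \<partial>(cube_measure :: (real ^ 'm) measure))"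
    by (rule Fubini') (simp add: case_prod_beta)
  also have "\<dots> \<le> (\<integral>\<^sup>+x. ennreal B \<partial>(cube_measure :: (real ^ 'm) measure))"
    by (intro nn_integral_mono on_line)
  also have "\<dots> = ennreal B" by (simp add: emeasure_restrict_space space_restrict_space)
  finally have le: "(\<integral>\<^sup>+x. ennreal (g x) \<partial>cube_measure) \<le> ennreal B" .
  have Ig: "integrable cube_measure g"
    using g_nonneg le by (intro integrableI_nonneg borel_measurable_cube)
      (auto simp: order_le_less_trans[OF le])
  \<comment> \<open>\<open>ennreal\<close> sends negative reals to 0, so returning to a real
    inequality requires a nonnegative bound.\<close>
  have Bpos: "B \<ge> 0"
  proof -
    have "cmod (c n) \<le> (\<Sum>n\<in>{0..N}. cmod (c n))" using n by (intro member_le_sum) auto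
    moreover have "ln (real (N choose n)) \<ge> 0" using n by (intro ln_ge_zero) (simp add: Suc_le_eq)
    ultimately show ?thesis using ln_cmod_le[of "c n" "\<Sum>n\<in>{0..N}. cmod (c n)"]
      by (simp add: B_def K_def sum_nonneg)
  qed
  have "ennreal (integral\<^sup>L cube_measure g) \<le> ennreal B"
    using le nn_integral_eq_integral[OF Ig] g_nonneg by simp
  hence gB: "integral\<^sup>L cube_measure g \<le> B" using Bpos by simp
  have I: "integrable cube_measure (\<lambda>_::real ^ 'm. K)"
    using finite_measure.integrable_const[OF finite_measure_cube] .
  define J where "J = integral\<^sup>L cube_measure (\<lambda>x. ln (cmod (F x)))"
  have "J = integral\<^sup>L cube_measure (\<lambda>x. K - g x)" by (simp add: g_def J_def)
  also have "\<dots> = K - integral\<^sup>L cube_measure g"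
    using I Ig by (simp add: space_restrict_space)
  finally have "ln (cmod (c n)) \<le> ln (real (N choose n)) + J" using gB by (simp add: B_def)
  hence "exp (ln (cmod (c n))) \<le> exp (ln (real (N choose n)) + J)" by simp
  moreover have "mahler_measure F = exp J"
    by (simp add: mahler_measure_def J_def set_lebesgue_integral_def integral_restrict_space)
  ultimately show ?thesis using False binom by (simp add: exp_add)
qed (simp add: mahler_measure_def)

theorem theorem1p2:
  fixes F :: "real ^ 'm \<Rightarrow> complex"
    and S :: "(int ^ 'm) set"
    and N :: nat
    and \<alpha> :: "real ^ 'm"
    and k :: "nat \<Rightarrow> int ^ 'm"
  assumes "trig_polynomial F"
    and "\<exists>x. F x \<noteq> 0"
    and "finite S" and "S \<noteq> {}" and "card S = N + 1"
    and "{j. fourier_coeff F j \<noteq> 0} \<subseteq> S"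
    and "rat_lin_indep \<alpha>"
    and "bij_betw k {0..N} S"
    and "strict_mono_on {0..N} (\<lambda>n. int_dot (k n) \<alpha>)"
  shows "\<forall>n\<in>{0..N}. cmod (fourier_coeff F (k n)) \<le> real (N choose n) * mahler_measure F"
proof -
  obtain T c where T: "finite T" "\<And>x. F x = (\<Sum>j\<in>T. c j * torus_char j x)"
    using assms(1) unfolding trig_polynomial_def by blast
  \<comment> \<open>Terms may be added or dropped between \<open>T\<close> and \<open>S\<close>,
    since Fourier coefficients vanish outside either set; the enumeration \<open>k\<close> then
    reindexes the sum.\<close>
  have F: "F x = (\<Sum>n\<in>{0..N}. fourier_coeff F (k n) * torus_char (k n) x)" for x
  proof -
    have "F x = (\<Sum>j\<in>T. fourier_coeff F j * torus_char j x)"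
      by (subst T(2), intro sum.cong refl) (simp add: fourier_coeff_sum[OF T])
    also have "\<dots> = (\<Sum>j\<in>S. fourier_coeff F j * torus_char j x)"
      using assms(3,6) T(1) fourier_coeff_sum[OF T]
      by (intro sum.mono_neutral_cong) (auto split: if_splits)
    also have "\<dots> = (\<Sum>n\<in>{0..N}. fourier_coeff F (k n) * torus_char (k n) x)"
      by (rule sum.reindex_bij_betw[OF assms(8), symmetric])
    finally show ?thesis .
  qed
  \<comment> \<open>The ordering induced by \<open>\<alpha>\<close> is carried over to an integer
    direction, along which \<open>F\<close> restricts to a one-variable trigonometric sum with
    integer frequencies.\<close>
  obtain a :: "int ^ 'm" where "strict_mono_on {0..N} (\<lambda>n. \<Sum>i\<in>UNIV. k n $ i * a $ i)"
    using integer_direction_preserving_order[OF assms(9)] .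
  from mahler_measure_coeff_bound[OF F this] show ?thesis by simp
qed

end
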